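(* Let $p>1$ and $H\in(0,1)$, and let $B^H=(B^H_t)_{t\in[0,1]}$ be a fractional Brownian motion with Hurst index $H$ (with continuous sample paths). Then $$\mathbb P(B^H\in\mathcal E^p)=\begin{cases}1,&H>1/p,\\0,&H\le1/p.\end{cases}$$ Equivalently, $B^H\in\mathcal E^p$ almost surely if and only if $H>1/p$.
   Context: A fractional Brownian motion (fBM) with Hurst index $H\in(0,1)$ on $[0,1]$ is a centered Gaussian process with covariance $\mathbb E[B^H_sB^H_t]=\frac12(s^{2H}+t^{2H}-|t-s|^{2H})$, $s,t\in[0,1]$; the continuous modification is used. $C([0,1])$ denotes the real-valued continuous functions on $[0,1]$, $\|\cdot\|_\infty$ the uniform norm. $\mathbb N_0=\{0,1,2,\dots\}$, $\mathbb N_{-1}=\{-1,0,1,\dots\}$. For $n\in\mathbb N_0$: $t_{n,k}=k2^{-n}$ for $0\le k\le 2^n$, $I_n=\{0,\dots,2^n-1\}$. Faber--Schauder coefficients of $f\in C([0,1])$: $\theta^f_{-1,0}=f(1)-f(0)$, and for $n\ge0$, $k\in I_n$, $\theta^f_{n,k}=2^{n/2}\big(2f(t_{n+1,2k+1})-f(t_{n,k})-f(t_{n,k+1})\big)$. Level energies ($p>1$): $\zeta_f^{(p)}(-1)=2^{1-\frac1p}|\theta^f_{-1,0}|$ and $\zeta_f^{(p)}(n)=\big(2^{-np/2}\sum_{k\in I_n}|\theta^f_{n,k}|^p\big)^{1/p}$ for $n\ge0$. Schauder tail sequence (of a path $f$; not to be confused with the Hurst index): $H_f(n)=\sum_{m=n}^\infty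 2^{-m/2}\sup_{k\in I_m}|\theta^f_{m,k}|\in[0,\infty]$ for $n\ge0$. Energy space ($p>1$): $\|f\|_{\mathcal E^p}=\|f\|_\infty+\|\zeta_f^{(p)}\|_{\ell^p(\mathbb N_{-1})}+\|H_f\|_{\ell^p(\mathbb N_0)}$ and $\mathcal E^p=\{f\in C([0,1]):\|f\|_{\mathcal E^p}<\infty\}$. *)

theory Defs
  imports "HOL-Probability.Probability"
begin

text \<open>Constants count as Gaussian random variables (variance zero); this is needed since a
  fractional Brownian motion vanishes at time 0. A process is Gaussian if all finite linear
  combinations of its values are Gaussian, i.e. its finite-dimensional laws are (possibly
  degenerate) multivariate normal.\<close>

definition gaussian_rv :: "'a measure \<Rightarrow> ('a \<Rightarrow> real) \<Rightarrow> bool" where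
  "gaussian_rv M X \<longleftrightarrow> X \<in> borel_measurable M \<and>
     (\<exists>\<mu> \<sigma>. (\<sigma> > 0 \<and> distributed M lborel X (normal_density \<mu> \<sigma>)) \<or>
            (\<sigma> = 0 \<and> (AE \<omega> in M. X \<omega> = \<mu>)))"

definition gaussian_process :: "'a measure \<Rightarrow> 'i set \<Rightarrow> ('i \<Rightarrow> 'a \<Rightarrow> real) \<Rightarrow> bool" where
  "gaussian_process M T X \<longleftrightarrow>
     (\<forall>F a. finite F \<and> F \<subseteq> T \<longrightarrow> gaussian_rv M (\<lambda>\<omega>. \<Sum>t\<in>F. a t * X t \<omega>))"

definition fractional_brownian_motion ::
    "'a measure \<Rightarrow> real \<Rightarrow> (real \<Rightarrow> 'a \<Rightarrow> real) \<Rightarrow> bool" where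
  "fractional_brownian_motion M H B \<longleftrightarrow>
     prob_space M \<and> 0 < H \<and> H < 1 \<and>
     gaussian_process M {0..1} B \<and>
     (\<forall>t\<in>{0..1}. integral\<^sup>L M (B t) = 0) \<and>
     (\<forall>s\<in>{0..1}. \<forall>t\<in>{0..1}. integral\<^sup>L M (\<lambda>\<omega>. B s \<omega> * B t \<omega>) =
        (s powr (2 * H) + t powr (2 * H) - \<bar>t - s\<bar> powr (2 * H)) / 2) \<and>
     (\<forall>\<omega>\<in>space M. continuous_on {0..1} (\<lambda>t. B t \<omega>))"

text \<open>A function on the unit interval is represented by a total function on the reals of which
  only the values on the unit interval matter. Levels are integers, level \<open>-1\<close> included.\<close>

definition dyadic_pt :: "int \<Rightarrow> nat \<Rightarrow> real" where
  "dyadic_pt n k = real k * 2 powi (- n)"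

definition level_idx :: "int \<Rightarrow> nat set" where
  "level_idx n = {0..<2 ^ nat n}"

definition schauder_coeff :: "(real \<Rightarrow> real) \<Rightarrow> int \<Rightarrow> nat \<Rightarrow> real" where
  "schauder_coeff f n k =
     (if n = -1 then f 1 - f 0
      else 2 powr (of_int n / 2) *
        (2 * f (dyadic_pt (n + 1) (2 * k + 1)) - f (dyadic_pt n k) - f (dyadic_pt n (k + 1))))"

definition level_energy :: "real \<Rightarrow> (real \<Rightarrow> real) \<Rightarrow> int \<Rightarrow> real" where
  "level_energy p f n =
     (if n = -1 then 2 powr (1 - 1 / p) * \<bar>schauder_coeff f (-1) 0\<bar>
      else (2 powr (- of_int n * p / 2) *
             (\<Sum>k\<in>level_idx n. \<bar>schauder_coeff f n k\<bar> powr p)) powr (1 / p))"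

definition schauder_tail :: "(real \<Rightarrow> real) \<Rightarrow> int \<Rightarrow> ennreal" where
  "schauder_tail f n =
     (\<Sum>\<^sub>\<infinity>m\<in>{n..}. ennreal (2 powr (- of_int m / 2) *
        (SUP k\<in>level_idx m. \<bar>schauder_coeff f m k\<bar>)))"

text \<open>Only meant for exponents \<open>a > 0\<close>.\<close>

definition ennreal_powr :: "ennreal \<Rightarrow> real \<Rightarrow> ennreal" where
  "ennreal_powr x a = (if x = \<infinity> then \<infinity> else ennreal (enn2real x powr a))"

definition lp_norm :: "real \<Rightarrow> 'i set \<Rightarrow> ('i \<Rightarrow> ennreal) \<Rightarrow> ennreal" where
  "lp_norm p A u = ennreal_powr (\<Sum>\<^sub>\<infinity>n\<in>A. ennreal_powr (u n) p) (1 / p)"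

definition energy_norm :: "real \<Rightarrow> (real \<Rightarrow> real) \<Rightarrow> ennreal" where
  "energy_norm p f =
     (SUP t\<in>{0..1}. ennreal \<bar>f t\<bar>) +
     lp_norm p {-1..} (\<lambda>n. ennreal (level_energy p f n)) +
     lp_norm p {0..} (schauder_tail f)"

definition energy_space :: "real \<Rightarrow> (real \<Rightarrow> real) set" where
  "energy_space p = {f. continuous_on {0..1} f \<and> energy_norm p f < \<infinity>}"

end

theory Submission
  imports Defs "HOL-Real_Asymp.Real_Asymp"
begin

text \<open>
  Write \<open>D n k\<close> for the second difference \<open>2 f(m) - f(l) - f(r)\<close> over the dyadic interval
  \<open>[l, r]\<close> of level \<open>n\<close> and index \<open>k\<close> with midpoint \<open>m\<close>. The Faber-Schauder coefficient is
  \<open>2\<^sup>n\<^sup>/\<^sup>2 D n k\<close>, and in all parts of the energy norm the powers of two cancel: the \<open>p\<close>-th power of the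
  level energy is \<open>S n = \<Sum>k. \<bar>D n k\<bar>\<^sup>p\<close>, and the summands of the Schauder tail are
  \<open>max\<^sub>k \<bar>D n k\<bar> \<le> (S n) powr (1/p)\<close>. Two consequences for a continuous function suffice:
  membership in the energy space forces \<open>S n \<longlonglongrightarrow> 0\<close>
  (\<open>energy_space_imp_level_power_sums_null\<close>), and geometric decay of \<open>S n\<close> implies membership
  (\<open>energy_space_if_geometric\<close>).

  For fractional Brownian motion, \<open>D n k\<close> is a centred Gaussian variable of variance
  \<open>(4 - 4\<^sup>H) h\<^sup>2\<^sup>H\<close> with \<open>h = 2\<^sup>-\<^sup>(\<^sup>n\<^sup>+\<^sup>1\<^sup>)\<close>, so the mean of \<open>S n\<close> is a positive constant times
  \<open>(2 powr (1 - H p)) ^ n\<close>. If \<open>H p > 1\<close> this is a convergent geometric sequence, and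
  \<open>S n\<close> almost surely decays at the square root of that rate, because the expectation of
  \<open>\<Sum>n. S n / (2 powr ((1 - H p) / 2)) ^ n\<close> is finite.

  If \<open>H p \<le> 1\<close> the mean of \<open>S n\<close> is bounded away from zero, and a law of large numbers is needed
  to see that \<open>S n\<close> itself does not tend to zero. Instead of \<open>\<bar>x\<bar>\<^sup>p\<close>, which would require
  bivariate Gaussian integrals, it is proved for \<open>cos x\<close>: products of cosines are linear in
  cosines of sums and differences, so the covariances of \<open>cos (D n j)\<close> and \<open>cos (D n k)\<close>, after
  normalisation, come from the characteristic functions of single Gaussian variables. If \<open>\<rho>\<close> is
  the correlation, the covariance is \<open>(cosh \<rho> - 1) / e\<close>. The correlation depends only on
  \<open>j - k\<close> and vanishes as \<open>\<bar>j - k\<bar> \<rightarrow> \<infinity>\<close>, so the average of the cosines over a level tends to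
  its mean \<open>exp (-1/2) < 3/4\<close> in the \<open>L\<^sup>2\<close> sense, hence almost surely along a subsequence of levels
  (\<open>cos_mean_variance_tendsto_0\<close>). The pointwise bound \<open>abs_powr_ge_cos\<close> turns this into a positive
  lower bound for \<open>S n\<close> along that subsequence.
\<close>

section \<open>The energy space in terms of dyadic second differences\<close>

text \<open>The norms are indexed by integer half-lines; this reduces all of them to ordinary series.\<close>
lemma infsum_int_atLeast:
  fixes g :: "int \<Rightarrow> ennreal"
  shows "(\<Sum>\<^sub>\<infinity>n\<in>{a..}. g n) = (\<Sum>n. g (a + int n))"
proof -
  have bij: "bij_betw (\<lambda>n. a + int n) UNIV {a..}"
    by (rule bij_betwI[where g = "\<lambda>m. nat (m - a)"]) auto
  have "(\<Sum>\<^sub>\<infinity>n\<in>{a..}. g n) = (\<Sum>\<^sub>\<infinity>n. g (a + int n))"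
    using infsum_reindex_bij_betw[OF bij, of g] by simp
  also have "\<dots> = (\<Sum>n. g (a + int n))"
    by (intro sums_unique has_sum_imp_sums has_sum_infsum nonneg_summable_on_complete) simp
  finally show ?thesis .
qed

lemma ennreal_powr_less_top_iff: "ennreal_powr x a < \<infinity> \<longleftrightarrow> x < \<infinity>"
  by (auto simp: ennreal_powr_def less_top)

lemma ennreal_powr_ennreal: "0 \<le> x \<Longrightarrow> ennreal_powr (ennreal x) a = ennreal (x powr a)"
  by (simp add: ennreal_powr_def)

lemma ennreal_powr_mono: "x \<le> y \<Longrightarrow> 0 \<le> a \<Longrightarrow> ennreal_powr x a \<le> ennreal_powr y a"
  by (cases x; cases y) (auto simp: ennreal_powr_def top_unique intro!: powr_mono2 ennreal_leI)

lemma borel_measurable_ennreal_powr [measurable (raw)]: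
  assumes [measurable]: "f \<in> borel_measurable M"
  shows "(\<lambda>x. ennreal_powr (f x) a) \<in> borel_measurable M"
  unfolding ennreal_powr_def by measurable

lemma lp_norm_int_less_top_iff:
  "lp_norm p {a..} u < \<infinity> \<longleftrightarrow> (\<Sum>n. ennreal_powr (u (a + int n)) p) < \<infinity>"
  by (simp only: lp_norm_def ennreal_powr_less_top_iff infsum_int_atLeast)

definition second_diff :: "(real \<Rightarrow> real) \<Rightarrow> nat \<Rightarrow> nat \<Rightarrow> real" where
  "second_diff f n k =
     2 * f (real (2 * k + 1) / 2 ^ (n + 1)) - f (real (2 * k) / 2 ^ (n + 1))
       - f (real (2 * k + 2) / 2 ^ (n + 1))"

definition level_power_sum :: "real \<Rightarrow> (real \<Rightarrow> real) \<Rightarrow> nat \<Rightarrow> real" where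
  "level_power_sum p f n = (\<Sum>k<2 ^ n. \<bar>second_diff f n k\<bar> powr p)"

lemma level_power_sum_nonneg: "0 \<le> level_power_sum p f n"
  by (simp add: level_power_sum_def sum_nonneg)

lemma schauder_coeff_second_diff:
  "schauder_coeff f (int n) k = 2 powr (real n / 2) * second_diff f n k"
proof -
  have pw: "(2::real) powi (- int n) = 1 / 2 ^ n" for n
    by (simp add: power_int_minus divide_inverse)
  have pw1: "(2::real) powi (- (int n + 1)) = 1 / 2 ^ (n + 1)"
    using pw[of "n + 1"] by (simp only: of_nat_add of_nat_1)
  show ?thesis
    by (simp del: minus_add_distrib add:
        schauder_coeff_def dyadic_pt_def second_diff_def pw pw1 add_divide_distrib)
qed

lemma level_energy_eq: "level_energy p f (int n) = level_power_sum p f n powr (1 / p)"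
proof -
  have "2 powr (- real n * p / 2) * (\<Sum>k<2 ^ n. \<bar>schauder_coeff f (int n) k\<bar> powr p)
      = level_power_sum p f n"
    unfolding level_power_sum_def sum_distrib_left schauder_coeff_second_diff
    by (intro sum.cong refl)
      (simp add: abs_mult powr_mult powr_powr mult.assoc[symmetric] powr_add[symmetric])
  then show ?thesis
    by (simp add: level_energy_def level_idx_def lessThan_atLeast0)
qed

lemma level_energy_powr:
  assumes "p > 0"
  shows "ennreal_powr (ennreal (level_energy p f (int n))) p = ennreal (level_power_sum p f n)"
  using assms level_power_sum_nonneg[of p f n]
  by (simp add: level_energy_eq ennreal_powr_ennreal powr_powr)

lemma schauder_tail_eq:
  "schauder_tail f (int n) = (\<Sum>i. ennreal (2 powr (- real (n + i) / 2) *
     (SUP k\<in>level_idx (int (n + i)). \<bar>schauder_coeff f (int (n + i)) k\<bar>)))"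
  by (simp only: schauder_tail_def infsum_int_atLeast of_nat_add of_int_add of_int_of_nat_eq)

lemma level_idx_ne: "level_idx n \<noteq> {}" and finite_level_idx: "finite (level_idx n)"
  by (simp_all add: level_idx_def)

text \<open>The largest entry of a finite family is at most its \<open>\<ell>\<^sup>p\<close> norm, so the Schauder tails are
  controlled by the level energies alone.\<close>
lemma level_sup_le:
  assumes "p > 0"
  shows "2 powr (- real m / 2) * (SUP k\<in>level_idx (int m). \<bar>schauder_coeff f (int m) k\<bar>)
     \<le> level_power_sum p f m powr (1 / p)"
proof -
  have D: "\<bar>second_diff f m k\<bar> \<le> level_power_sum p f m powr (1 / p)" if "k < 2 ^ m" for k
  proof -
    have "\<bar>second_diff f m k\<bar> = (\<bar>second_diff f m k\<bar> powr p) powr (1 / p)"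
      using assms by (simp add: powr_powr)
    also have "\<dots> \<le> level_power_sum p f m powr (1 / p)"
      unfolding level_power_sum_def using assms that
      by (intro powr_mono2 member_le_sum) auto
    finally show ?thesis .
  qed
  have "(SUP k\<in>level_idx (int m). \<bar>schauder_coeff f (int m) k\<bar>)
     \<le> 2 powr (real m / 2) * level_power_sum p f m powr (1 / p)"
    using D by (intro cSUP_least level_idx_ne)
      (auto simp: level_idx_def schauder_coeff_second_diff abs_mult)
  then have "2 powr (- real m / 2) * (SUP k\<in>level_idx (int m). \<bar>schauder_coeff f (int m) k\<bar>)
     \<le> 2 powr (- real m / 2) * (2 powr (real m / 2) * level_power_sum p f m powr (1 / p))"
    by (intro mult_left_mono) auto
  also have "\<dots> = level_power_sum p f m powr (1 / p)"
    by (simp add: mult.assoc[symmetric] powr_add[symmetric])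
  finally show ?thesis .
qed

text \<open>The uniform norm of a continuous function on a compact interval is finite, which leaves the two
  countable conditions.\<close>
lemma energy_space_iff:
  assumes "continuous_on {0..1} f"
  shows "f \<in> energy_space p \<longleftrightarrow>
    lp_norm p {-1..} (\<lambda>n. ennreal (level_energy p f n)) < \<infinity> \<and>
    lp_norm p {0..} (schauder_tail f) < \<infinity>"
proof -
  have "bounded (f ` {0..1})"
    using assms by (intro compact_imp_bounded compact_continuous_image) auto
  then obtain C where C: "\<And>t. t \<in> {0..1} \<Longrightarrow> \<bar>f t\<bar> \<le> C"
    unfolding bounded_iff by (metis imageI real_norm_def)
  have "(SUP t\<in>{0..1}. ennreal \<bar>f t\<bar>) \<le> ennreal C"
    by (intro SUP_least ennreal_leI C)
  then have "(SUP t\<in>{0..1}. ennreal \<bar>f t\<bar>) < \<infinity>"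
    by (simp add: le_less_trans)
  then show ?thesis
    using assms by (auto simp: energy_space_def energy_norm_def less_top)
qed

text \<open>The series of the power sums is dominated by the \<open>p\<close>-th power of the norm of the level energies,
  so it converges.\<close>
lemma energy_space_imp_level_power_sums_null:
  assumes "p > 0" and "f \<in> energy_space p"
  shows "level_power_sum p f \<longlonglongrightarrow> 0"
proof -
  let ?g = "\<lambda>n. ennreal_powr (ennreal (level_energy p f (-1 + int n))) p"
  have "(\<Sum>n. ?g n) < \<infinity>"
    using assms(2) energy_space_iff[of f p] unfolding lp_norm_int_less_top_iff
    by (simp add: energy_space_def)
  moreover have "(\<Sum>n. ennreal (level_power_sum p f n)) \<le> (\<Sum>n. ?g n)"
  proof -
    have "(\<Sum>n. ennreal (level_power_sum p f n)) = (\<Sum>n. ?g (n + 1))"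
      using assms(1) by (simp add: level_energy_powr)
    also have "\<dots> \<le> (\<Sum>n. ?g n)"
      by (subst suminf_offset[of ?g 1]) auto
    finally show ?thesis .
  qed
  ultimately have "summable (level_power_sum p f)"
    by (intro summable_suminf_not_top level_power_sum_nonneg) (auto simp: top_unique)
  then show ?thesis
    by (rule summable_LIMSEQ_zero)
qed

text \<open>The tails of a geometric series are again geometric; therefore the same rate bounds the level
  energies and the Schauder tail, and both have a finite \<open>\<ell>\<^sup>p\<close> norm.\<close>
lemma energy_space_if_geometric:
  assumes p: "p > 0" and f: "continuous_on {0..1} f"
    and q: "0 < q" "q < 1" and C: "0 \<le> C"
    and bound: "\<And>n. level_power_sum p f n powr (1 / p) \<le> C * q ^ n"
  shows "f \<in> energy_space p"
proof -
  define r where "r = q powr p"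
  have r: "0 \<le> r" "r < 1"
    using p q by (simp_all add: r_def powr01_less_one)
  have pow: "(D * q ^ n) powr p = D powr p * r ^ n" if "0 \<le> D" for D n
  proof -
    have "(q ^ n) powr p = r ^ n"
      using q by (simp add: r_def powr_powr powr_realpow[symmetric] mult.commute)
    then show ?thesis using that q by (simp add: powr_mult)
  qed
  have geo: "(\<Sum>n. ennreal (D * x ^ n)) = ennreal (D / (1 - x))"
    if "0 \<le> x" "x < 1" "0 \<le> D" for x D :: real
    using that by (intro suminf_ennreal_eq)
      (auto intro: sums_mult[OF geometric_sums, of x D, simplified])
  \<comment> \<open>Level \<open>-1\<close> contributes a single finite term.\<close>
  have "(\<Sum>n. ennreal_powr (ennreal (level_energy p f (-1 + int n))) p)
     = (\<Sum>n. ennreal (level_power_sum p f n)) + ennreal_powr (ennreal (level_energy p f (-1))) p"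
    using p by (subst suminf_offset[of _ 1]) (auto simp: level_energy_powr)
  moreover have "(\<Sum>n. ennreal (level_power_sum p f n)) \<le> (\<Sum>n. ennreal (C powr p * r ^ n))"
  proof (intro suminf_le ennreal_leI)
    fix n
    have "level_power_sum p f n = (level_power_sum p f n powr (1 / p)) powr p"
      using p level_power_sum_nonneg[of p f n] by (simp add: powr_powr)
    also have "\<dots> \<le> (C * q ^ n) powr p"
      using p bound by (intro powr_mono2) auto
    finally show "level_power_sum p f n \<le> C powr p * r ^ n"
      using pow[OF C] by simp
  qed auto
  moreover have "(\<Sum>n. ennreal (C powr p * r ^ n)) < \<infinity>"
    using geo[OF r] by simp
  ultimately have E: "lp_norm p {-1..} (\<lambda>n. ennreal (level_energy p f n)) < \<infinity>"
    unfolding lp_norm_int_less_top_iff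
    by (auto simp: ennreal_powr_ennreal level_energy_def ennreal_powr_less_top_iff)
  have tail: "schauder_tail f (int n) \<le> ennreal (C / (1 - q) * q ^ n)" for n
  proof -
    have "schauder_tail f (int n) \<le> (\<Sum>i. ennreal (C * q ^ n * q ^ i))"
      unfolding schauder_tail_eq
    proof (intro suminf_le ennreal_leI)
      fix i
      show "2 powr (- real (n + i) / 2) *
          (SUP k\<in>level_idx (int (n + i)). \<bar>schauder_coeff f (int (n + i)) k\<bar>) \<le> C * q ^ n * q ^ i"
        using level_sup_le[OF p, of "n + i" f] bound[of "n + i"]
        by (simp add: power_add mult.assoc)
    qed auto
    also have "\<dots> = ennreal (C * q ^ n / (1 - q))"
      using C q by (intro geo) auto
    also have "C * q ^ n / (1 - q) = C / (1 - q) * q ^ n"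
      by simp
    finally show ?thesis .
  qed
  have "(\<Sum>n. ennreal_powr (schauder_tail f (0 + int n)) p)
     \<le> (\<Sum>n. ennreal ((C / (1 - q)) powr p * r ^ n))"
  proof (intro suminf_le)
    fix n
    have "ennreal_powr (schauder_tail f (0 + int n)) p
        \<le> ennreal_powr (ennreal (C / (1 - q) * q ^ n)) p"
      using p tail by (intro ennreal_powr_mono) auto
    also have "\<dots> = ennreal ((C / (1 - q)) powr p * r ^ n)"
      using C q pow[of "C / (1 - q)" n] by (subst ennreal_powr_ennreal) auto
    finally show "ennreal_powr (schauder_tail f (0 + int n)) p
        \<le> ennreal ((C / (1 - q)) powr p * r ^ n)" .
  qed auto
  also have "\<dots> < \<infinity>"
    using geo[OF r] by simp
  finally have "lp_norm p {0..} (schauder_tail f) < \<infinity>"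
    unfolding lp_norm_int_less_top_iff .
  with E show ?thesis
    using energy_space_iff[OF f] by simp
qed

text \<open>After the uniform norm has been discarded, membership depends on the path through its values at
  the countably many dyadic points only.\<close>
lemma sets_energy_space:
  assumes B[measurable]: "\<And>t. t \<in> {0..1} \<Longrightarrow> B t \<in> borel_measurable M"
    and cont: "\<And>\<omega>. \<omega> \<in> space M \<Longrightarrow> continuous_on {0..1} (\<lambda>t. B t \<omega>)"
  shows "{\<omega> \<in> space M. (\<lambda>t. B t \<omega>) \<in> energy_space p} \<in> sets M"
proof -
  have node: "real i / 2 ^ (n + 1) \<in> {0..1}" if "i \<le> 2 ^ (n + 1)" for i n :: nat
  proof -
    have "real i \<le> 2 ^ (n + 1)"
      using that by (metis of_nat_le_iff of_nat_numeral of_nat_power)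
    then show ?thesis by simp
  qed
  have diff: "(\<lambda>\<omega>. second_diff (\<lambda>t. B t \<omega>) n k) \<in> borel_measurable M" if "k < 2 ^ n" for n k
  proof -
    have "2 * k + 2 \<le> 2 ^ (n + 1)" using that by simp
    then show ?thesis
      unfolding second_diff_def
      by (intro borel_measurable_times borel_measurable_diff borel_measurable_const B node) auto
  qed
  have energy: "(\<lambda>\<omega>. level_energy p (\<lambda>t. B t \<omega>) (-1 + int n)) \<in> borel_measurable M" for n
  proof (cases n)
    case 0
    have [measurable]: "B 0 \<in> borel_measurable M" "B 1 \<in> borel_measurable M" by auto
    show ?thesis using 0 by (simp add: level_energy_def schauder_coeff_def)
  next
    case (Suc m)
    have "(\<lambda>\<omega>. level_energy p (\<lambda>t. B t \<omega>) (int m)) \<in> borel_measurable M"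
      unfolding level_energy_eq level_power_sum_def
      by (intro powr_real_measurable borel_measurable_sum borel_measurable_abs
          borel_measurable_const diff) simp
    then show ?thesis using Suc by simp
  qed
  have tail: "(\<lambda>\<omega>. schauder_tail (\<lambda>t. B t \<omega>) (int n)) \<in> borel_measurable M" for n
  proof -
    have sup: "(\<lambda>\<omega>. SUP k\<in>level_idx (int m). \<bar>schauder_coeff (\<lambda>t. B t \<omega>) (int m) k\<bar>)
      \<in> borel_measurable M" for m
      unfolding schauder_coeff_second_diff
      by (intro borel_measurable_cSUP borel_measurable_abs borel_measurable_times
          borel_measurable_const diff countable_finite finite_level_idx bdd_above_finite
          finite_imageI) (simp add: level_idx_def)
    show ?thesis
      unfolding schauder_tail_eq
      by (intro borel_measurable_suminf_order measurable_compose[OF _ measurable_ennreal]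
          borel_measurable_times borel_measurable_const sup)
  qed
  note [measurable] = energy tail
  have "{\<omega> \<in> space M. (\<lambda>t. B t \<omega>) \<in> energy_space p} =
     {\<omega> \<in> space M. (\<Sum>n. ennreal_powr (ennreal (level_energy p (\<lambda>t. B t \<omega>) (-1 + int n))) p) < \<infinity> \<and>
        (\<Sum>n. ennreal_powr (schauder_tail (\<lambda>t. B t \<omega>) (int n)) p) < \<infinity>}"
    using cont
    by (intro Collect_cong conj_cong refl)
      (simp only: energy_space_iff lp_norm_int_less_top_iff add_0_left)
  also have "\<dots> \<in> sets M" by measurable
  finally show ?thesis .
qed

section \<open>Centred Gaussian variables\<close>

lemma (in prob_space) gaussian_rv_square_integrable:
  assumes "gaussian_rv M X"
  shows "integrable M X" and "integrable M (\<lambda>\<omega>. (X \<omega>)\<^sup>2)"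
proof -
  have [measurable]: "X \<in> borel_measurable M"
    using assms by (simp add: gaussian_rv_def)
  have "integrable M X \<and> integrable M (\<lambda>\<omega>. (X \<omega>)\<^sup>2)"
  proof -
    from assms consider
      \<mu> \<sigma> where "\<sigma> > 0" "distributed M lborel X (normal_density \<mu> \<sigma>)"
      | \<mu> where "AE \<omega> in M. X \<omega> = \<mu>"
      unfolding gaussian_rv_def by blast
    then show ?thesis
    proof cases
      case (1 \<mu> \<sigma>)
      have c: "integrable M (\<lambda>\<omega>. (X \<omega> - \<mu>) ^ k)" for k
        using distributed_integrable[OF 1(2), of "\<lambda>x. (x - \<mu>) ^ k"]
          integrable_normal_moment[OF 1(1), of \<mu> k] by simp
      have "integrable M (\<lambda>\<omega>. (X \<omega> - \<mu>) ^ 1 + \<mu>)"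
        by (intro Bochner_Integration.integrable_add c integrable_const)
      moreover have "integrable M (\<lambda>\<omega>. (X \<omega> - \<mu>) ^ 2 + 2 * \<mu> * (X \<omega> - \<mu>) ^ 1 + \<mu>\<^sup>2)"
        by (intro Bochner_Integration.integrable_add integrable_mult_right c integrable_const)
      moreover have "(X \<omega> - \<mu>) ^ 2 + 2 * \<mu> * (X \<omega> - \<mu>) ^ 1 + \<mu>\<^sup>2 = (X \<omega>)\<^sup>2" for \<omega>
        by (simp add: power2_eq_square algebra_simps)
      ultimately show ?thesis by simp
    next
      case (2 \<mu>)
      have "integrable M X \<longleftrightarrow> integrable M (\<lambda>_. \<mu>)"
        by (intro integrable_cong_AE) (use 2 in auto)
      moreover have "integrable M (\<lambda>\<omega>. (X \<omega>)\<^sup>2) \<longleftrightarrow> integrable M (\<lambda>_. \<mu>\<^sup>2)"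
        by (intro integrable_cong_AE) (use 2 in auto)
      ultimately show ?thesis by simp
    qed
  qed
  then show "integrable M X" and "integrable M (\<lambda>\<omega>. (X \<omega>)\<^sup>2)" by auto
qed

lemma (in prob_space) gaussian_rv_mult_integrable:
  assumes "gaussian_rv M X" "gaussian_rv M Y"
  shows "integrable M (\<lambda>\<omega>. X \<omega> * Y \<omega>)"
proof (rule Bochner_Integration.integrable_bound)
  show "integrable M (\<lambda>\<omega>. (X \<omega>)\<^sup>2 + (Y \<omega>)\<^sup>2)"
    using assms by (intro Bochner_Integration.integrable_add gaussian_rv_square_integrable)
  show "(\<lambda>\<omega>. X \<omega> * Y \<omega>) \<in> borel_measurable M"
    using assms by (auto simp: gaussian_rv_def)
  have "\<bar>x * y\<bar> \<le> x\<^sup>2 + y\<^sup>2" for x y :: real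
    using sum_squares_bound[of x y] sum_squares_bound[of x "- y"]
      zero_le_power2[of x] zero_le_power2[of y]
    unfolding abs_le_iff by (simp; linarith)
  then show "AE \<omega> in M. norm (X \<omega> * Y \<omega>) \<le> norm ((X \<omega>)\<^sup>2 + (Y \<omega>)\<^sup>2)"
    by simp
qed

text \<open>A centred Gaussian variable is determined by its second moment; this replaces the unspecified
  parameters in the definition by that moment.\<close>
lemma (in prob_space) centered_gaussian_cases:
  assumes "gaussian_rv M X" "expectation X = 0"
  obtains (normal) "expectation (\<lambda>\<omega>. (X \<omega>)\<^sup>2) > 0"
      "distributed M lborel (\<lambda>\<omega>. X \<omega> / sqrt (expectation (\<lambda>\<omega>. (X \<omega>)\<^sup>2))) std_normal_density"
    | (null) "expectation (\<lambda>\<omega>. (X \<omega>)\<^sup>2) = 0" "AE \<omega> in M. X \<omega> = 0"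
proof -
  have [measurable]: "X \<in> borel_measurable M"
    using assms by (simp add: gaussian_rv_def)
  from assms(1) consider
    (a) \<mu> \<sigma> where "\<sigma> > 0" "distributed M lborel X (normal_density \<mu> \<sigma>)"
    | (b) \<mu> where "AE \<omega> in M. X \<omega> = \<mu>"
    unfolding gaussian_rv_def by blast
  then show thesis
  proof cases
    case (a \<mu> \<sigma>)
    have "\<mu> = 0"
      using normal_distributed_expectation[OF a] assms(2) by simp
    moreover have "expectation (\<lambda>\<omega>. (X \<omega>)\<^sup>2) = \<sigma>\<^sup>2"
      using normal_distributed_variance[OF a] assms(2) by simp
    moreover have "distributed M lborel (\<lambda>\<omega>. (X \<omega> - \<mu>) / \<sigma>) std_normal_density"
      using a normal_standard_normal_convert[OF a(1)] by simp
    ultimately show thesis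
      using a(1) by (intro normal) auto
  next
    case (b \<mu>)
    have "expectation X = expectation (\<lambda>_. \<mu>)"
      by (intro integral_cong_AE) (use b in auto)
    then have "\<mu> = 0"
      using assms(2) by (simp add: prob_space)
    moreover have "expectation (\<lambda>\<omega>. (X \<omega>)\<^sup>2) = expectation (\<lambda>_. \<mu>\<^sup>2)"
      by (intro integral_cong_AE) (use b in auto)
    ultimately show thesis
      using b by (intro null) (auto simp: prob_space)
  qed
qed

text \<open>The real part of the characteristic function.\<close>
lemma integral_cos_std_normal:
  "(\<integral>x. cos (t * x) \<partial>std_normal_distribution) = exp (- t\<^sup>2 / 2)"
proof -
  interpret N: real_distribution std_normal_distribution
    by (rule real_dist_normal_dist)
  have "complex_of_real (exp (- t\<^sup>2 / 2)) = (CLINT x|std_normal_distribution. iexp (t * x))"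
    using fun_cong[OF char_std_normal_distribution, of t] by (simp add: char_def)
  then have "exp (- t\<^sup>2 / 2) = Re (CLINT x|std_normal_distribution. iexp (t * x))"
    by (metis Re_complex_of_real)
  also have "\<dots> = (\<integral>x. Re (iexp (t * x)) \<partial>std_normal_distribution)"
    by (intro integral_Re[symmetric] N.integrable_iexp) auto
  finally show ?thesis
    by (simp add: Re_exp)
qed

text \<open>The degenerate case is included, since the difference of a standardised second difference with
  itself occurs below.\<close>
lemma (in prob_space) expectation_cos_gaussian:
  assumes "gaussian_rv M X" "expectation X = 0"
  shows "expectation (\<lambda>\<omega>. cos (X \<omega>)) = exp (- expectation (\<lambda>\<omega>. (X \<omega>)\<^sup>2) / 2)"
  using assms
proof (cases rule: centered_gaussian_cases)
  case normal
  let ?s = "sqrt (expectation (\<lambda>\<omega>. (X \<omega>)\<^sup>2))"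
  have s: "?s > 0" using normal(1) by simp
  have "expectation (\<lambda>\<omega>. cos (?s * (X \<omega> / ?s)))
      = (\<integral>x. std_normal_density x * cos (?s * x) \<partial>lborel)"
    using normal(2) by (intro distributed_integral[symmetric]) auto
  also have "\<dots> = (\<integral>x. cos (?s * x) \<partial>std_normal_distribution)"
    by (subst integral_real_density) auto
  also have "\<dots> = exp (- ?s\<^sup>2 / 2)"
    by (rule integral_cos_std_normal)
  finally show ?thesis
    using s normal(1) by simp
next
  case null
  have [measurable]: "X \<in> borel_measurable M"
    using assms by (simp add: gaussian_rv_def)
  have "expectation (\<lambda>\<omega>. cos (X \<omega>)) = expectation (\<lambda>_. 1)"
    by (intro integral_cong_AE) (use null in auto)
  then show ?thesis
    using null by (simp add: prob_space)
qed

definition normal_abs_moment :: "real \<Rightarrow> ennreal" where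
  "normal_abs_moment p =
     (\<integral>\<^sup>+x. ennreal (std_normal_density x) * ennreal (\<bar>x\<bar> powr p) \<partial>lborel)"

lemma normal_abs_moment_finite:
  assumes "p > 0"
  shows "normal_abs_moment p < \<infinity>"
proof -
  define m where "m = nat \<lceil>p\<rceil>"
  \<comment> \<open>Bounding by an integer power reduces the claim to the integer absolute moments.\<close>
  have le: "\<bar>x\<bar> powr p \<le> 1 + \<bar>x\<bar> ^ m" for x :: real
  proof (cases "\<bar>x\<bar> \<le> 1")
    case True
    then have "\<bar>x\<bar> powr p \<le> 1"
      using assms powr_mono2[of p "\<bar>x\<bar>" 1] by simp
    then show ?thesis by (simp add: add_increasing2)
  next
    case False
    then have "\<bar>x\<bar> powr p \<le> \<bar>x\<bar> powr real m"
      unfolding m_def by (intro powr_mono real_nat_ceiling_ge) simp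
    then show ?thesis
      using False by (simp add: powr_realpow)
  qed
  have int: "integrable lborel (\<lambda>x. std_normal_density x * (1 + \<bar>x\<bar> ^ m))"
    using integrable_normal_moment_abs[of 1 0 0] integrable_normal_moment_abs[of 1 0 m]
    by (simp add: distrib_left)
  have "normal_abs_moment p \<le> (\<integral>\<^sup>+x. ennreal (std_normal_density x * (1 + \<bar>x\<bar> ^ m)) \<partial>lborel)"
    unfolding normal_abs_moment_def
    by (intro nn_integral_mono)
      (auto simp: ennreal_mult'[symmetric] intro!: ennreal_leI mult_left_mono le)
  also have "\<dots> < \<infinity>"
    using int by (subst nn_integral_eq_integral) auto
  finally show ?thesis .
qed

lemma (in prob_space) gaussian_abs_moment:
  assumes "gaussian_rv M X" "expectation X = 0" and v: "v > 0" "expectation (\<lambda>\<omega>. (X \<omega>)\<^sup>2) = v"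
  shows "(\<integral>\<^sup>+\<omega>. ennreal (\<bar>X \<omega>\<bar> powr p) \<partial>M) = ennreal (v powr (p / 2)) * normal_abs_moment p"
proof -
  have D: "distributed M lborel (\<lambda>\<omega>. X \<omega> / sqrt v) std_normal_density"
    using centered_gaussian_cases[OF assms(1,2)] v by (metis less_irrefl)
  have [measurable]: "X \<in> borel_measurable M"
    using assms by (simp add: gaussian_rv_def)
  have "sqrt v powr p = v powr (p / 2)"
    using v by (simp add: powr_half_sqrt[symmetric] powr_powr)
  then have "\<bar>x\<bar> powr p = v powr (p / 2) * \<bar>x / sqrt v\<bar> powr p" for x
    using v by (simp add: abs_divide powr_divide)
  then have "(\<integral>\<^sup>+\<omega>. ennreal (\<bar>X \<omega>\<bar> powr p) \<partial>M)
      = (\<integral>\<^sup>+\<omega>. ennreal (v powr (p / 2)) * ennreal (\<bar>X \<omega> / sqrt v\<bar> powr p) \<partial>M)"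
    by (simp add: ennreal_mult'[symmetric])
  also have "\<dots> = ennreal (v powr (p / 2)) * (\<integral>\<^sup>+\<omega>. ennreal (\<bar>X \<omega> / sqrt v\<bar> powr p) \<partial>M)"
    by (intro nn_integral_cmult) auto
  also have "(\<integral>\<^sup>+\<omega>. ennreal (\<bar>X \<omega> / sqrt v\<bar> powr p) \<partial>M) = normal_abs_moment p"
    unfolding normal_abs_moment_def
    using distributed_nn_integral[OF D, of "\<lambda>x. ennreal (\<bar>x\<bar> powr p)"] by simp
  finally show ?thesis .
qed

text \<open>Gaussian processes are defined through sums over sets of times. The family version allows
  repeated times, which occur when neighbouring dyadic intervals share an endpoint.\<close>
lemma gaussian_process_linear_combination:
  assumes "gaussian_process M T X" "finite I" "s ` I \<subseteq> T"
  shows "gaussian_rv M (\<lambda>\<omega>. \<Sum>i\<in>I. c i * X (s i) \<omega>)"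
proof -
  have "gaussian_rv M (\<lambda>\<omega>. \<Sum>t\<in>s ` I. (\<Sum>i\<in>{i\<in>I. s i = t}. c i) * X t \<omega>)"
    using assms(1)[unfolded gaussian_process_def, rule_format, of "s ` I"
        "\<lambda>t. \<Sum>i\<in>{i\<in>I. s i = t}. c i"] assms(2,3)
    by simp
  also have "(\<lambda>\<omega>. \<Sum>t\<in>s ` I. (\<Sum>i\<in>{i\<in>I. s i = t}. c i) * X t \<omega>) = (\<lambda>\<omega>. \<Sum>i\<in>I. c i * X (s i) \<omega>)"
  proof
    fix \<omega>
    have "(\<Sum>i\<in>I. c i * X (s i) \<omega>) = (\<Sum>t\<in>s ` I. \<Sum>i\<in>{i\<in>I. s i = t}. c i * X (s i) \<omega>)"
      by (rule sum.image_gen[OF assms(2)])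
    also have "\<dots> = (\<Sum>t\<in>s ` I. (\<Sum>i\<in>{i\<in>I. s i = t}. c i) * X t \<omega>)"
      by (intro sum.cong refl) (simp add: sum_distrib_right)
    finally show "(\<Sum>t\<in>s ` I. (\<Sum>i\<in>{i\<in>I. s i = t}. c i) * X t \<omega>) = (\<Sum>i\<in>I. c i * X (s i) \<omega>)"
      by simp
  qed
  finally show ?thesis .
qed

lemma gaussian_process_linear_combination_add:
  assumes "gaussian_process M T X" "finite I" "s ` I \<subseteq> T" "finite J" "u ` J \<subseteq> T"
  shows "gaussian_rv M (\<lambda>\<omega>. (\<Sum>i\<in>I. c i * X (s i) \<omega>) + (\<Sum>j\<in>J. d j * X (u j) \<omega>))"
proof -
  have "gaussian_rv M (\<lambda>\<omega>. \<Sum>i\<in>I <+> J. case_sum c d i * X (case_sum s u i) \<omega>)"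
    using assms by (intro gaussian_process_linear_combination) auto
  then show ?thesis
    using assms by (simp add: sum.Plus)
qed

section \<open>The covariance of second differences and its decay\<close>

text \<open>The covariance of two second differences with unit step whose midpoints have distance \<open>u\<close>. The
  coefficients \<open>1, -4, 6, -4, 1\<close> are the convolution of \<open>-1, 2, -1\<close> with itself.\<close>
definition sec_diff_cov :: "real \<Rightarrow> real \<Rightarrow> real" where
  "sec_diff_cov H u =
     - (\<bar>u - 2\<bar> powr (2 * H) - 4 * \<bar>u - 1\<bar> powr (2 * H) + 6 * \<bar>u\<bar> powr (2 * H)
        - 4 * \<bar>u + 1\<bar> powr (2 * H) + \<bar>u + 2\<bar> powr (2 * H)) / 2"

lemma sec_diff_cov_0: "sec_diff_cov H 0 = 4 - 4 powr H"
proof -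
  have "(2::real) powr (2 * H) = 4 powr H"
    by (simp add: powr_powr[symmetric])
  then show ?thesis by (simp add: sec_diff_cov_def)
qed

text \<open>In the limiting case \<open>H = 1\<close> the paths are linear and their second differences vanish.\<close>
lemma sec_diff_cov_0_pos: "H < 1 \<Longrightarrow> sec_diff_cov H 0 > 0"
  using powr_less_mono[of H 1 "4::real"] by (simp add: sec_diff_cov_0)

text \<open>Swapping the two intervals does not change the covariance, so only the distance of their indices
  matters.\<close>
lemma sec_diff_cov_minus: "sec_diff_cov H (- u) = sec_diff_cov H u"
proof -
  have "\<bar>- u - a\<bar> = \<bar>u + a\<bar>" "\<bar>- u + a\<bar> = \<bar>u - a\<bar>" for a :: real by linarith+
  then show ?thesis by (simp add: sec_diff_cov_def)
qed

text \<open>The mean value theorem, applied first to \<open>\<lambda>y. (y + 1) powr a - y powr a\<close> and then to the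
  derivative of the power, gives the value \<open>a (a - 1) w powr (a - 2)\<close> at some \<open>w > x - 1\<close>.\<close>
lemma powr_second_difference_bound:
  fixes x a :: real
  assumes "a \<le> 2" "1 < x"
  shows "\<bar>(x + 1) powr a - 2 * x powr a + (x - 1) powr a\<bar>
    \<le> \<bar>a * (a - 1)\<bar> * (x - 1) powr (a - 2)"
proof -
  define \<phi> where "\<phi> y = (y + 1) powr a - y powr a" for y :: real
  define \<phi>' where "\<phi>' y = a * (y + 1) powr (a - 1) - a * y powr (a - 1)" for y :: real
  have d\<phi>: "(\<phi> has_real_derivative \<phi>' y) (at y)" if "0 < y" for y
    unfolding \<phi>_def \<phi>'_def using that by (auto intro!: derivative_eq_intros)
  have "\<exists>z>x - 1. z < x \<and> \<phi> x - \<phi> (x - 1) = (x - (x - 1)) * \<phi>' z"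
    by (rule MVT2) (use assms d\<phi> in auto)
  then obtain z where z: "x - 1 < z" "z < x" "\<phi> x - \<phi> (x - 1) = \<phi>' z" by auto
  have "\<exists>w>z. w < z + 1 \<and> (z + 1) powr (a - 1) - z powr (a - 1)
      = (z + 1 - z) * ((a - 1) * w powr (a - 1 - 1))"
    by (rule MVT2) (use assms z in \<open>auto intro!: derivative_eq_intros\<close>)
  then obtain w where w: "z < w" "(z + 1) powr (a - 1) - z powr (a - 1) = (a - 1) * w powr (a - 2)"
    by auto
  have "(x + 1) powr a - 2 * x powr a + (x - 1) powr a = \<phi> x - \<phi> (x - 1)"
    by (simp add: \<phi>_def)
  also have "\<dots> = a * (a - 1) * w powr (a - 2)"
    using z(3) w(2) by (simp add: \<phi>'_def right_diff_distrib[symmetric])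
  finally have "\<bar>(x + 1) powr a - 2 * x powr a + (x - 1) powr a\<bar> = \<bar>a * (a - 1)\<bar> * w powr (a - 2)"
    by (simp add: abs_mult)
  also have "\<dots> \<le> \<bar>a * (a - 1)\<bar> * (x - 1) powr (a - 2)"
    using assms z w by (intro mult_left_mono powr_mono2') auto
  finally show ?thesis .
qed

lemma powr_second_difference_tendsto_0:
  fixes a :: real
  assumes "a < 2"
  shows "((\<lambda>x. (x + 1) powr a - 2 * x powr a + (x - 1) powr a) \<longlongrightarrow> 0) at_top"
proof (rule Lim_null_comparison)
  show "\<forall>\<^sub>F x in at_top. norm ((x + 1) powr a - 2 * x powr a + (x - 1) powr a)
      \<le> \<bar>a * (a - 1)\<bar> * (x - 1) powr (a - 2)"
    using eventually_gt_at_top[of 1]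
    by eventually_elim (use powr_second_difference_bound[of a] assms in auto)
  have "((\<lambda>x. (x - 1) powr (a - 2)) \<longlongrightarrow> 0) at_top"
    using assms by real_asymp
  then show "((\<lambda>x. \<bar>a * (a - 1)\<bar> * (x - 1) powr (a - 2)) \<longlongrightarrow> 0) at_top"
    by (rule tendsto_mult_right_zero)
qed

text \<open>A fourth difference is the second difference of second differences, and the latter tend to
  zero already.\<close>
lemma sec_diff_cov_tendsto_0:
  assumes "H < 1"
  shows "(sec_diff_cov H \<longlongrightarrow> 0) at_top"
proof -
  define g where "g x = (x + 1) powr (2 * H) - 2 * x powr (2 * H) + (x - 1) powr (2 * H)" for x :: real
  have g: "(g \<longlongrightarrow> 0) at_top"
    unfolding g_def using assms by (intro powr_second_difference_tendsto_0) auto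
  have "((\<lambda>u. g (u + 1)) \<longlongrightarrow> 0) at_top" "((\<lambda>u. g (u - 1)) \<longlongrightarrow> 0) at_top"
    by (rule filterlim_compose[OF g], real_asymp)+
  then have "((\<lambda>u. - (g (u + 1) - 2 * g u + g (u - 1)) / 2) \<longlongrightarrow> - (0 - 2 * 0 + 0) / 2) at_top"
    by (intro tendsto_intros g) auto
  moreover have "\<forall>\<^sub>F u in at_top. - (g (u + 1) - 2 * g u + g (u - 1)) / 2 = sec_diff_cov H u"
    using eventually_gt_at_top[of 2]
  proof eventually_elim
    case (elim u)
    then show ?case
      by (simp add: g_def sec_diff_cov_def abs_if algebra_simps)
  qed
  ultimately show ?thesis
    using Lim_transform_eventually by fastforce
qed

section \<open>Averaging, and a comparison with the cosine\<close>

lemma cesaro_null: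
  fixes a :: "nat \<Rightarrow> real"
  assumes a: "a \<longlonglongrightarrow> 0" and pos: "\<And>n. 0 \<le> a n"
  shows "(\<lambda>N. (\<Sum>d<N. a d) / real N) \<longlonglongrightarrow> 0"
proof (rule LIMSEQ_I)
  fix e :: real assume e: "e > 0"
  \<comment> \<open>Beyond \<open>K\<close> all terms are small; the sum \<open>S\<close> of the first ones is negligible against \<open>N\<close>.\<close>
  obtain K where K: "\<And>d. d \<ge> K \<Longrightarrow> a d < e / 2"
    using order_tendstoD(2)[OF a, of "e / 2"] e by (auto simp: eventually_sequentially)
  define S where "S = (\<Sum>d<K. a d)"
  have S: "S \<ge> 0" unfolding S_def by (intro sum_nonneg pos)
  obtain L :: nat where L: "2 * S / e < real L"
    using reals_Archimedean2 by blast
  have "norm ((\<Sum>d<N. a d) / real N - 0) < e" if N: "N \<ge> L" for N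
  proof -
    have "0 \<le> 2 * S / e" "2 * S / e < real N"
      using S e L N by (simp, linarith)
    then have N0: "real N > 0" and SN: "S < e / 2 * real N"
      using e by (linarith, simp add: field_simps)
    have "(\<Sum>d<N. a d) \<le> (\<Sum>d<N. (if d < K then a d else 0) + e / 2)"
      using K e by (intro sum_mono) (auto simp: not_less intro: less_imp_le)
    also have "\<dots> = (\<Sum>d\<in>{..<N} \<inter> {..<K}. a d) + e / 2 * real N"
      by (simp add: sum.distrib sum.inter_restrict[symmetric])
        (simp add: sum.inter_restrict)
    also have "(\<Sum>d\<in>{..<N} \<inter> {..<K}. a d) \<le> S"
      unfolding S_def by (intro sum_mono2 pos) auto
    finally have "(\<Sum>d<N. a d) < e * real N"
      using SN by simp
    moreover have "0 \<le> (\<Sum>d<N. a d)" by (intro sum_nonneg pos)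
    ultimately show ?thesis
      using N0 by (simp add: field_simps)
  qed
  then show "\<exists>no. \<forall>n\<ge>no. norm ((\<Sum>d<n. a d) / real n - 0) < e" by blast
qed

text \<open>Each row of the matrix contains every value \<open>a d\<close> at most twice, so a row mean is at most twice
  the Cesaro mean.\<close>
lemma toeplitz_mean_null:
  fixes a :: "nat \<Rightarrow> real"
  assumes a: "a \<longlonglongrightarrow> 0" and pos: "\<And>n. 0 \<le> a n"
  shows "(\<lambda>N. (\<Sum>j<N. \<Sum>k<N. a (nat \<bar>int k - int j\<bar>)) / (real N)\<^sup>2) \<longlonglongrightarrow> 0"
proof (rule Lim_null_comparison)
  have row: "(\<Sum>k<N. a (nat \<bar>int k - int j\<bar>)) \<le> 2 * (\<Sum>d<N. a d)" if "j < N" for j N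
  proof -
    have "(\<Sum>k<N. a (nat \<bar>int k - int j\<bar>))
        \<le> (\<Sum>k\<in>{..j}. a (nat \<bar>int k - int j\<bar>)) + (\<Sum>k\<in>{j..<N}. a (nat \<bar>int k - int j\<bar>))"
      by (subst sum.union_inter[symmetric])
        (auto intro!: add_increasing2 sum_nonneg mult_nonneg_nonneg pos sum_mono2)
    also have "(\<Sum>k\<in>{..j}. a (nat \<bar>int k - int j\<bar>)) = (\<Sum>d\<in>(\<lambda>k. j - k) ` {..j}. a d)"
      by (subst sum.reindex) (auto simp: inj_on_def intro!: sum.cong arg_cong[where f = a])
    also have "\<dots> \<le> (\<Sum>d<N. a d)"
      using that by (intro sum_mono2 pos) auto
    also have "(\<Sum>k\<in>{j..<N}. a (nat \<bar>int k - int j\<bar>)) = (\<Sum>d\<in>(\<lambda>k. k - j) ` {j..<N}. a d)"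
      by (subst sum.reindex) (auto simp: inj_on_def intro!: sum.cong arg_cong[where f = a])
    also have "\<dots> \<le> (\<Sum>d<N. a d)"
      using that by (intro sum_mono2 pos) auto
    finally show ?thesis by simp
  qed
  have "norm ((\<Sum>j<N. \<Sum>k<N. a (nat \<bar>int k - int j\<bar>)) / (real N)\<^sup>2) \<le> 2 * ((\<Sum>d<N. a d) / real N)" for N
  proof -
    have "(\<Sum>j<N. \<Sum>k<N. a (nat \<bar>int k - int j\<bar>)) \<le> (\<Sum>j<N. 2 * (\<Sum>d<N. a d))"
      by (intro sum_mono row) simp
    then have "(\<Sum>j<N. \<Sum>k<N. a (nat \<bar>int k - int j\<bar>)) / (real N)\<^sup>2
        \<le> (real N * (2 * (\<Sum>d<N. a d))) / (real N)\<^sup>2"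
      by (intro divide_right_mono) auto
    moreover have "0 \<le> (\<Sum>j<N. \<Sum>k<N. a (nat \<bar>int k - int j\<bar>)) / (real N)\<^sup>2"
      by (intro divide_nonneg_nonneg sum_nonneg pos) simp
    ultimately show ?thesis
      by (cases "N = 0") (simp_all add: power2_eq_square)
  qed
  then show "\<forall>\<^sub>F N in sequentially. norm ((\<Sum>j<N. \<Sum>k<N. a (nat \<bar>int k - int j\<bar>)) / (real N)\<^sup>2)
      \<le> 2 * ((\<Sum>d<N. a d) / real N)"
    by simp
  show "(\<lambda>N. 2 * ((\<Sum>d<N. a d) / real N)) \<longlonglongrightarrow> 0"
    using tendsto_mult_right_zero[OF cesaro_null[OF a pos]] .
qed

text \<open>If \<open>\<bar>x\<bar> \<ge> 1/2\<close> the factor \<open>7/8 - cos x\<close> is at most \<open>2\<close>; if \<open>\<bar>x\<bar> < 1/2\<close> it is negative because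
  \<open>1 - cos x \<le> x\<^sup>2 / 2\<close>. The constant \<open>7/8\<close> has to exceed \<open>exp (-1/2)\<close>, the mean of the cosine of a
  standard normal variable, for the bound to be positive on average.\<close>
lemma abs_powr_ge_cos:
  fixes x p :: real
  assumes "p > 0"
  shows "(1/2) powr p / 2 * (7/8 - cos x) \<le> \<bar>x\<bar> powr p"
proof (cases "\<bar>x\<bar> \<ge> 1/2")
  case True
  have "7/8 - cos x \<le> 2"
    using cos_ge_minus_one[of x] by linarith
  then have "(1/2) powr p / 2 * (7/8 - cos x) \<le> (1/2) powr p / 2 * 2"
    by (intro mult_left_mono) auto
  also have "\<dots> \<le> \<bar>x\<bar> powr p"
    using True assms by (auto intro!: powr_mono2)
  finally show ?thesis .
next
  case False
  have "x\<^sup>2 \<le> (1/2)\<^sup>2"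
    using False by (intro power2_le_iff_abs_le[THEN iffD2]) auto
  moreover have "cos x = 1 - 2 * (sin (x/2))\<^sup>2"
    using cos_double_sin[of "x/2"] by simp
  moreover have "(sin (x/2))\<^sup>2 \<le> x\<^sup>2 / 4"
    using power_mono[OF abs_sin_x_le_abs_x[of "x/2"], of 2] by (simp add: power_divide)
  ultimately have "7/8 - cos x \<le> 0"
    by (simp add: power2_eq_square)
  then have "(1/2) powr p / 2 * (7/8 - cos x) \<le> 0"
    by (intro mult_nonneg_nonpos) auto
  then show ?thesis using order.trans powr_ge_zero by blast
qed

section \<open>Second differences of fractional Brownian motion\<close>

locale fbm =
  fixes M :: "'a measure" and H :: real and B :: "real \<Rightarrow> 'a \<Rightarrow> real"
  assumes fbm: "fractional_brownian_motion M H B"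
begin

sublocale prob_space M
  using fbm by (simp add: fractional_brownian_motion_def)

lemma H_bounds: "0 < H" "H < 1"
  and gaussian: "gaussian_process M {0..1} B"
  and mean: "t \<in> {0..1} \<Longrightarrow> expectation (B t) = 0"
  and cov: "s \<in> {0..1} \<Longrightarrow> t \<in> {0..1} \<Longrightarrow> expectation (\<lambda>\<omega>. B s \<omega> * B t \<omega>) =
        (s powr (2 * H) + t powr (2 * H) - \<bar>t - s\<bar> powr (2 * H)) / 2"
  and continuous_paths: "\<omega> \<in> space M \<Longrightarrow> continuous_on {0..1} (\<lambda>t. B t \<omega>)"
  using fbm by (auto simp: fractional_brownian_motion_def)

lemma gaussian_B: "t \<in> {0..1} \<Longrightarrow> gaussian_rv M (B t)"
  using gaussian_process_linear_combination[OF gaussian, of "{()}" "\<lambda>_. t" "\<lambda>_. 1"] by simp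

text \<open>All probabilistic arguments concern these variables. They are linear combinations, with
  weights \<open>-1, 2, -1\<close>, of the values at three consecutive points of the grid of the next level.\<close>
abbreviation D :: "nat \<Rightarrow> nat \<Rightarrow> 'a \<Rightarrow> real" where
  "D n k \<omega> \<equiv> second_diff (\<lambda>t. B t \<omega>) n k"

definition node :: "nat \<Rightarrow> nat \<Rightarrow> nat \<Rightarrow> real" where
  "node n k i = real (2 * k + i) / 2 ^ (n + 1)"

definition weight :: "nat \<Rightarrow> real" where
  "weight i = (if i = 1 then 2 else -1)"

lemma D_eq_sum: "D n k \<omega> = (\<Sum>i<3. weight i * B (node n k i) \<omega>)"
  by (simp add: second_diff_def node_def weight_def numeral_3_eq_3 ac_simps)

lemma node_mem: "k < 2 ^ n \<Longrightarrow> i < 3 \<Longrightarrow> node n k i \<in> {0..1}"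
proof -
  assume "k < 2 ^ n" "i < 3"
  then have "2 * k + i \<le> 2 ^ (n + 1)" by simp
  then have "real (2 * k + i) \<le> 2 ^ (n + 1)"
    by (metis of_nat_le_iff of_nat_numeral of_nat_power)
  then show ?thesis by (simp add: node_def)
qed

lemma gaussian_D_combination:
  assumes "j < 2 ^ n" "k < 2 ^ n"
  shows "gaussian_rv M (\<lambda>\<omega>. a * D n j \<omega> + b * D n k \<omega>)"
proof -
  have "gaussian_rv M (\<lambda>\<omega>. (\<Sum>i<3. (a * weight i) * B (node n j i) \<omega>)
      + (\<Sum>i<3. (b * weight i) * B (node n k i) \<omega>))"
    by (intro gaussian_process_linear_combination_add[OF gaussian]) (use assms node_mem in auto)
  then show ?thesis
    by (simp add: D_eq_sum sum_distrib_left mult.assoc)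
qed

lemma gaussian_D: "k < 2 ^ n \<Longrightarrow> gaussian_rv M (D n k)"
  using gaussian_D_combination[of k n k 1 0] by simp

lemma expectation_D:
  assumes "k < 2 ^ n"
  shows "expectation (D n k) = 0"
proof -
  have "expectation (D n k) = (\<Sum>i<3. expectation (\<lambda>\<omega>. weight i * B (node n k i) \<omega>))"
    unfolding D_eq_sum
    by (intro Bochner_Integration.integral_sum integrable_mult_right
        gaussian_rv_square_integrable(1) gaussian_B node_mem assms) simp
  also have "\<dots> = (\<Sum>i<3::nat. 0)"
    by (intro sum.cong refl) (use mean[OF node_mem[OF assms]] in simp)
  finally show ?thesis by simp
qed

lemma cov_node:
  assumes "j < 2 ^ n" "k < 2 ^ n" "i < 3" "l < 3"
  shows "expectation (\<lambda>\<omega>. B (node n j i) \<omega> * B (node n k l) \<omega>) =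
    (node n j i powr (2 * H) + node n k l powr (2 * H)
      - (1 / 2 ^ (n + 1)) powr (2 * H) * \<bar>2 * (real k - real j) + (real l - real i)\<bar> powr (2 * H)) / 2"
proof -
  have "\<bar>node n k l - node n j i\<bar>
     = (1 / 2 ^ (n + 1)) * \<bar>2 * (real k - real j) + (real l - real i)\<bar>"
  proof -
    have "node n k l - node n j i = (1 / 2 ^ (n + 1)) * (2 * (real k - real j) + (real l - real i))"
      by (simp add: node_def field_simps)
    then show ?thesis by (simp only: abs_mult) simp
  qed
  then show ?thesis
    using cov[OF node_mem[OF assms(1,3)] node_mem[OF assms(2,4)]] by (simp only: powr_mult)
qed

text \<open>The weights have sum zero, so the terms of the covariance that depend on a single time cancel
  and only those with the distance of two times remain; by self-similarity the grid size factors
  out.\<close>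
lemma expectation_D_mult:
  assumes "j < 2 ^ n" "k < 2 ^ n"
  shows "expectation (\<lambda>\<omega>. D n j \<omega> * D n k \<omega>)
    = (1 / 2 ^ (n + 1)) powr (2 * H) * sec_diff_cov H (2 * (real k - real j))"
proof -
  have int: "integrable M (\<lambda>\<omega>. B (node n j i) \<omega> * B (node n k l) \<omega>)" if "i < 3" "l < 3" for i l
    using assms that by (intro gaussian_rv_mult_integrable gaussian_B node_mem)
  have "D n j \<omega> * D n k \<omega> = (\<Sum>i<3. \<Sum>l<3. weight i * weight l *
      (B (node n j i) \<omega> * B (node n k l) \<omega>))" for \<omega>
    unfolding D_eq_sum sum_product by (intro sum.cong refl) simp
  then have "expectation (\<lambda>\<omega>. D n j \<omega> * D n k \<omega>) = expectation (\<lambda>\<omega>. \<Sum>i<3. \<Sum>l<3.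
      weight i * weight l * (B (node n j i) \<omega> * B (node n k l) \<omega>))"
    by simp
  also have "\<dots> = (\<Sum>i<3. expectation (\<lambda>\<omega>. \<Sum>l<3.
      weight i * weight l * (B (node n j i) \<omega> * B (node n k l) \<omega>)))"
    by (intro Bochner_Integration.integral_sum Bochner_Integration.integrable_sum
        integrable_mult_right int) simp_all
  also have "\<dots> = (\<Sum>i<3. \<Sum>l<3. expectation (\<lambda>\<omega>.
      weight i * weight l * (B (node n j i) \<omega> * B (node n k l) \<omega>)))"
    by (intro sum.cong refl Bochner_Integration.integral_sum integrable_mult_right int) simp_all
  also have "\<dots> = (\<Sum>i<3. \<Sum>l<3. weight i * weight l *
      expectation (\<lambda>\<omega>. B (node n j i) \<omega> * B (node n k l) \<omega>))"
    by simp
  also have "\<dots> = (\<Sum>i<3. \<Sum>l<3. weight i * weight l * 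
      ((node n j i powr (2 * H) + node n k l powr (2 * H)
      - (1 / 2 ^ (n + 1)) powr (2 * H) * \<bar>2 * (real k - real j) + (real l - real i)\<bar> powr (2 * H)) / 2))"
    using assms by (intro sum.cong refl) (simp add: cov_node)
  also have "\<dots> = (1 / 2 ^ (n + 1)) powr (2 * H) * sec_diff_cov H (2 * (real k - real j))"
  proof -
    define d where "d = 2 * (real k - real j)"
    define s where "s = (1 / 2 ^ (n + 1) :: real) powr (2 * H)"
    show ?thesis
      unfolding d_def[symmetric] s_def[symmetric]
      by (simp add: weight_def numeral_3_eq_3 sec_diff_cov_def)
        (simp add: field_simps)
  qed
  finally show ?thesis .
qed

end

section \<open>Averages of the cosine over a level\<close>

context fbm begin

definition level_var :: "nat \<Rightarrow> real" where
  "level_var n = (1 / 2 ^ (n + 1)) powr (2 * H) * sec_diff_cov H 0"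

lemma level_var_pos: "level_var n > 0"
  using H_bounds sec_diff_cov_0_pos by (simp add: level_var_def)

lemma expectation_D_square: "k < 2 ^ n \<Longrightarrow> expectation (\<lambda>\<omega>. (D n k \<omega>)\<^sup>2) = level_var n"
  using expectation_D_mult[of k n k] by (simp add: level_var_def power2_eq_square)

definition diff_corr :: "nat \<Rightarrow> real" where
  "diff_corr d = sec_diff_cov H (2 * real d) / sec_diff_cov H 0"

lemma diff_corr_0: "diff_corr 0 = 1"
  using H_bounds sec_diff_cov_0_pos[of H] by (simp add: diff_corr_def)

lemma diff_corr_tendsto_0: "diff_corr \<longlonglongrightarrow> 0"
proof -
  have "filterlim (\<lambda>d. 2 * real d) at_top sequentially" by real_asymp
  from filterlim_compose[OF sec_diff_cov_tendsto_0[OF H_bounds(2)] this]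
  show ?thesis
    unfolding diff_corr_def by (rule tendsto_divide_zero)
qed

definition std_diff :: "nat \<Rightarrow> nat \<Rightarrow> 'a \<Rightarrow> real" where
  "std_diff n k \<omega> = D n k \<omega> / sqrt (level_var n)"

lemma D_eq_std_diff: "D n k \<omega> = sqrt (level_var n) * std_diff n k \<omega>"
  using level_var_pos[of n] by (simp add: std_diff_def)

lemma gaussian_std_diff_combination:
  assumes "j < 2 ^ n" "k < 2 ^ n"
  shows "gaussian_rv M (\<lambda>\<omega>. a * std_diff n j \<omega> + b * std_diff n k \<omega>)"
  using gaussian_D_combination[OF assms, of "a / sqrt (level_var n)" "b / sqrt (level_var n)"]
  by (simp add: std_diff_def)

lemma gaussian_std_diff: "k < 2 ^ n \<Longrightarrow> gaussian_rv M (std_diff n k)"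
  using gaussian_std_diff_combination[of k n k 1 0] by simp

lemma std_diff_measurable: "k < 2 ^ n \<Longrightarrow> std_diff n k \<in> borel_measurable M"
  using gaussian_std_diff by (simp add: gaussian_rv_def)

lemma expectation_std_diff: "k < 2 ^ n \<Longrightarrow> expectation (std_diff n k) = 0"
  unfolding std_diff_def[abs_def] by (simp add: expectation_D)

lemma expectation_std_diff_mult:
  assumes "j < 2 ^ n" "k < 2 ^ n"
  shows "expectation (\<lambda>\<omega>. std_diff n j \<omega> * std_diff n k \<omega>) = diff_corr (nat \<bar>int k - int j\<bar>)"
proof -
  have "sqrt (level_var n) * sqrt (level_var n) = level_var n"
    using level_var_pos[of n] by simp
  then have "expectation (\<lambda>\<omega>. std_diff n j \<omega> * std_diff n k \<omega>)
      = expectation (\<lambda>\<omega>. D n j \<omega> * D n k \<omega>) / level_var n"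
    by (simp add: std_diff_def)
  also have "\<dots> = sec_diff_cov H (2 * (real k - real j)) / sec_diff_cov H 0"
    using assms by (simp add: expectation_D_mult level_var_def)
  also have "sec_diff_cov H (2 * (real k - real j)) = sec_diff_cov H (2 * real (nat \<bar>int k - int j\<bar>))"
  proof (cases "j \<le> k")
    case True
    then have "real (nat \<bar>int k - int j\<bar>) = real k - real j" by simp
    then show ?thesis by (simp only:)
  next
    case False
    then have "2 * real (nat \<bar>int k - int j\<bar>) = - (2 * (real k - real j))" by simp
    then show ?thesis by (simp only: sec_diff_cov_minus)
  qed
  finally show ?thesis by (simp add: diff_corr_def)
qed

lemma expectation_cos_combination:
  assumes jk: "j < 2 ^ n" "k < 2 ^ n"
  shows "expectation (\<lambda>\<omega>. cos (std_diff n j \<omega> + b * std_diff n k \<omega>))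
     = exp (- (1 + 2 * b * diff_corr (nat \<bar>int k - int j\<bar>) + b\<^sup>2) / 2)"
proof -
  have int: "integrable M (\<lambda>\<omega>. std_diff n i \<omega> * std_diff n l \<omega>)" if "i < 2 ^ n" "l < 2 ^ n" for i l
    using that by (intro gaussian_rv_mult_integrable gaussian_std_diff)
  have g: "gaussian_rv M (\<lambda>\<omega>. std_diff n j \<omega> + b * std_diff n k \<omega>)"
    using gaussian_std_diff_combination[OF jk, of 1 b] by simp
  have "expectation (\<lambda>\<omega>. std_diff n j \<omega> + b * std_diff n k \<omega>) = 0"
    using jk gaussian_rv_square_integrable(1)[OF gaussian_std_diff] by (simp add: expectation_std_diff)
  moreover have "expectation (\<lambda>\<omega>. (std_diff n j \<omega> + b * std_diff n k \<omega>)\<^sup>2)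
      = 1 + 2 * b * diff_corr (nat \<bar>int k - int j\<bar>) + b\<^sup>2"
  proof -
    have "(std_diff n j \<omega> + b * std_diff n k \<omega>)\<^sup>2
        = std_diff n j \<omega> * std_diff n j \<omega> + 2 * b * (std_diff n j \<omega> * std_diff n k \<omega>)
        + b\<^sup>2 * (std_diff n k \<omega> * std_diff n k \<omega>)" for \<omega>
      by (simp add: power2_eq_square algebra_simps)
    then have "expectation (\<lambda>\<omega>. (std_diff n j \<omega> + b * std_diff n k \<omega>)\<^sup>2)
        = expectation (\<lambda>\<omega>. std_diff n j \<omega> * std_diff n j \<omega>)
        + 2 * b * expectation (\<lambda>\<omega>. std_diff n j \<omega> * std_diff n k \<omega>)
        + b\<^sup>2 * expectation (\<lambda>\<omega>. std_diff n k \<omega> * std_diff n k \<omega>)"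
      using int jk by simp
    then show ?thesis
      using jk by (simp add: expectation_std_diff_mult diff_corr_0)
  qed
  ultimately show ?thesis
    using expectation_cos_gaussian[OF g] by simp
qed

lemma expectation_cos_std_diff: "k < 2 ^ n \<Longrightarrow> expectation (\<lambda>\<omega>. cos (std_diff n k \<omega>)) = exp (- 1 / 2)"
  using expectation_cos_combination[of k n k 0] by simp

lemma integrable_cos_std_diff: "k < 2 ^ n \<Longrightarrow> integrable M (\<lambda>\<omega>. cos (std_diff n k \<omega>))"
  by (intro integrable_const_bound[of _ 1] measurable_compose[OF std_diff_measurable]) auto

text \<open>The product of two cosines is the mean of the cosines of sum and difference, both of which are
  Gaussian with variances \<open>2 + 2 \<rho>\<close> and \<open>2 - 2 \<rho>\<close>, \<open>\<rho>\<close> being the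
  correlation.\<close>
lemma cov_cos_std_diff:
  assumes jk: "j < 2 ^ n" "k < 2 ^ n"
  shows "integrable M (\<lambda>\<omega>. (cos (std_diff n j \<omega>) - exp (- 1 / 2)) * (cos (std_diff n k \<omega>) - exp (- 1 / 2)))"
    and "expectation (\<lambda>\<omega>. (cos (std_diff n j \<omega>) - exp (- 1 / 2)) * (cos (std_diff n k \<omega>) - exp (- 1 / 2)))
      = exp (- 1) * (cosh (diff_corr (nat \<bar>int k - int j\<bar>)) - 1)"
proof -
  note [measurable] = std_diff_measurable[OF jk(1)] std_diff_measurable[OF jk(2)]
  let ?m = "exp (- 1 / 2) :: real" and ?r = "diff_corr (nat \<bar>int k - int j\<bar>)"
  have int: "integrable M (\<lambda>\<omega>. cos (std_diff n j \<omega> + b * std_diff n k \<omega>))" for b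
    by (intro integrable_const_bound[of _ 1]) auto
  have eq: "(cos x - ?m) * (cos y - ?m)
     = (cos (x + 1 * y) + cos (x + (-1) * y)) / 2 - ?m * cos x - ?m * cos y + ?m\<^sup>2" for x y
    by (simp add: cos_add cos_diff power2_eq_square algebra_simps)
  show "integrable M (\<lambda>\<omega>. (cos (std_diff n j \<omega>) - ?m) * (cos (std_diff n k \<omega>) - ?m))"
    unfolding eq using jk
    by (intro Bochner_Integration.integrable_add Bochner_Integration.integrable_diff
        integrable_divide integrable_mult_right int integrable_cos_std_diff integrable_const)
  have "expectation (\<lambda>\<omega>. (cos (std_diff n j \<omega>) - ?m) * (cos (std_diff n k \<omega>) - ?m))
     = (expectation (\<lambda>\<omega>. cos (std_diff n j \<omega> + 1 * std_diff n k \<omega>))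
          + expectation (\<lambda>\<omega>. cos (std_diff n j \<omega> + (-1) * std_diff n k \<omega>))) / 2
       - ?m * expectation (\<lambda>\<omega>. cos (std_diff n j \<omega>)) - ?m * expectation (\<lambda>\<omega>. cos (std_diff n k \<omega>)) + ?m\<^sup>2"
    unfolding eq using int[of 1] int[of "-1"] integrable_cos_std_diff jk
    by (simp add: prob_space)
  also have "\<dots> = (exp (- (1 + ?r)) + exp (- (1 - ?r))) / 2 - ?m * ?m - ?m * ?m + ?m\<^sup>2"
  proof -
    have "- (1 + 2 * 1 * ?r + 1\<^sup>2) / 2 = - (1 + ?r)"
      "- (1 + 2 * (-1) * ?r + (-1)\<^sup>2) / 2 = - (1 - ?r)"
      by simp_all
    then show ?thesis
      by (simp only: expectation_cos_combination[OF jk] expectation_cos_std_diff[OF jk(1)]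
          expectation_cos_std_diff[OF jk(2)])
  qed
  also have "?m\<^sup>2 = exp (- 1)"
    by (simp add: power2_eq_square exp_add[symmetric])
  also have "?m * ?m = exp (- 1)"
    by (simp add: exp_add[symmetric])
  also have "(exp (- (1 + ?r)) + exp (- (1 - ?r))) / 2 - exp (- 1) - exp (- 1) + exp (- 1)
      = exp (- 1) * (cosh ?r - 1)"
  proof -
    have "exp (- (1 + ?r)) = exp (- 1) * exp (- ?r)" "exp (- (1 - ?r)) = exp (- 1) * exp ?r"
      by (simp_all add: exp_add[symmetric])
    then show ?thesis
      by (simp add: cosh_field_def algebra_simps add_divide_distrib)
  qed
  finally show "expectation (\<lambda>\<omega>. (cos (std_diff n j \<omega>) - ?m) * (cos (std_diff n k \<omega>) - ?m))
      = exp (- 1) * (cosh ?r - 1)" .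
qed

definition cos_mean :: "nat \<Rightarrow> 'a \<Rightarrow> real" where
  "cos_mean n \<omega> = (\<Sum>k<2 ^ n. cos (std_diff n k \<omega>)) / 2 ^ n"

lemma cos_mean_variance:
  shows "integrable M (\<lambda>\<omega>. (cos_mean n \<omega> - exp (- 1 / 2))\<^sup>2)"
    and "expectation (\<lambda>\<omega>. (cos_mean n \<omega> - exp (- 1 / 2))\<^sup>2)
      = exp (- 1) * ((\<Sum>j<2 ^ n. \<Sum>k<2 ^ n. cosh (diff_corr (nat \<bar>int k - int j\<bar>)) - 1) / (real (2 ^ n))\<^sup>2)"
proof -
  let ?Y = "\<lambda>k \<omega>. cos (std_diff n k \<omega>) - exp (- 1 / 2)"
  have "cos_mean n \<omega> - exp (- 1 / 2) = (\<Sum>k<2 ^ n. ?Y k \<omega>) / 2 ^ n" for \<omega>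
    by (simp add: cos_mean_def sum_subtractf diff_divide_distrib)
  then have eq: "(cos_mean n \<omega> - exp (- 1 / 2))\<^sup>2
      = (\<Sum>j<2 ^ n. \<Sum>k<2 ^ n. ?Y j \<omega> * ?Y k \<omega>) / (real (2 ^ n))\<^sup>2" for \<omega>
    by (simp add: power_divide power2_eq_square[of "sum _ _"] sum_product)
  show "integrable M (\<lambda>\<omega>. (cos_mean n \<omega> - exp (- 1 / 2))\<^sup>2)"
    unfolding eq by (intro integrable_divide Bochner_Integration.integrable_sum cov_cos_std_diff) simp_all
  have "expectation (\<lambda>\<omega>. (cos_mean n \<omega> - exp (- 1 / 2))\<^sup>2)
      = expectation (\<lambda>\<omega>. \<Sum>j<2 ^ n. \<Sum>k<2 ^ n. ?Y j \<omega> * ?Y k \<omega>) / (real (2 ^ n))\<^sup>2"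
    unfolding eq by (rule integral_divide_zero)
  also have "expectation (\<lambda>\<omega>. \<Sum>j<2 ^ n. \<Sum>k<2 ^ n. ?Y j \<omega> * ?Y k \<omega>)
      = (\<Sum>j<2 ^ n. expectation (\<lambda>\<omega>. \<Sum>k<2 ^ n. ?Y j \<omega> * ?Y k \<omega>))"
    by (intro Bochner_Integration.integral_sum Bochner_Integration.integrable_sum cov_cos_std_diff) simp_all
  also have "\<dots> = (\<Sum>j<2 ^ n. \<Sum>k<2 ^ n. expectation (\<lambda>\<omega>. ?Y j \<omega> * ?Y k \<omega>))"
    by (intro sum.cong refl Bochner_Integration.integral_sum cov_cos_std_diff) simp_all
  also have "\<dots> = (\<Sum>j<2 ^ n. \<Sum>k<2 ^ n. exp (- 1) * (cosh (diff_corr (nat \<bar>int k - int j\<bar>)) - 1))"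
    by (intro sum.cong refl cov_cos_std_diff) simp_all
  finally show "expectation (\<lambda>\<omega>. (cos_mean n \<omega> - exp (- 1 / 2))\<^sup>2)
      = exp (- 1) * ((\<Sum>j<2 ^ n. \<Sum>k<2 ^ n. cosh (diff_corr (nat \<bar>int k - int j\<bar>)) - 1) / (real (2 ^ n))\<^sup>2)"
    by (simp only: sum_distrib_left[symmetric] times_divide_eq_right)
qed

text \<open>The variance of the mean is an average of the covariances, which form a Toeplitz matrix with
  entries tending to zero away from the diagonal.\<close>
lemma cos_mean_variance_tendsto_0:
  "(\<lambda>n. expectation (\<lambda>\<omega>. (cos_mean n \<omega> - exp (- 1 / 2))\<^sup>2)) \<longlonglongrightarrow> 0"
proof -
  have "(\<lambda>d. cosh (diff_corr d) - 1) \<longlonglongrightarrow> cosh 0 - 1"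
    by (intro tendsto_diff tendsto_const tendsto_cosh diff_corr_tendsto_0)
  then have "(\<lambda>N. (\<Sum>j<N. \<Sum>k<N. cosh (diff_corr (nat \<bar>int k - int j\<bar>)) - 1) / (real N)\<^sup>2) \<longlonglongrightarrow> 0"
    by (intro toeplitz_mean_null) (auto simp: cosh_real_ge_1)
  moreover have "filterlim (\<lambda>n. 2 ^ n :: nat) at_top sequentially"
    by (rule filterlim_subseq) (simp add: strict_mono_def)
  ultimately have "(\<lambda>n. (\<Sum>j<2 ^ n. \<Sum>k<2 ^ n. cosh (diff_corr (nat \<bar>int k - int j\<bar>)) - 1) / (real (2 ^ n))\<^sup>2)
      \<longlonglongrightarrow> 0"
    by (rule filterlim_compose)
  then show ?thesis
    unfolding cos_mean_variance(2) by (rule tendsto_mult_right_zero)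
qed

section \<open>The zero-one dichotomy\<close>

lemma level_power_sum_ge_cos_mean:
  assumes "p > 0"
  shows "level_power_sum p (\<lambda>t. B t \<omega>) n
    \<ge> level_var n powr (p / 2) * 2 ^ n * ((1/2) powr p / 2 * (7/8 - cos_mean n \<omega>))"
proof -
  have "\<bar>D n k \<omega>\<bar> powr p = level_var n powr (p / 2) * \<bar>std_diff n k \<omega>\<bar> powr p" for k
    using level_var_pos[of n]
    by (simp add: D_eq_std_diff abs_mult powr_mult powr_half_sqrt[symmetric] powr_powr)
  then have "level_power_sum p (\<lambda>t. B t \<omega>) n
      = level_var n powr (p / 2) * (\<Sum>k<2 ^ n. \<bar>std_diff n k \<omega>\<bar> powr p)"
    by (simp add: level_power_sum_def sum_distrib_left)
  also have "\<dots> \<ge> level_var n powr (p / 2) * (\<Sum>k<2 ^ n. (1/2) powr p / 2 * (7/8 - cos (std_diff n k \<omega>)))"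
    using assms by (intro mult_left_mono sum_mono abs_powr_ge_cos) auto
  also have "(\<Sum>k<2 ^ n. (1/2) powr p / 2 * (7/8 - cos (std_diff n k \<omega>)))
      = 2 ^ n * ((1/2) powr p / 2 * (7/8 - cos_mean n \<omega>))"
  proof -
    have "(\<Sum>k<2 ^ n. 7/8 - cos (std_diff n k \<omega>)) = 2 ^ n * (7/8 - cos_mean n \<omega>)"
      by (simp add: sum_subtractf cos_mean_def right_diff_distrib)
    then show ?thesis
      unfolding sum_distrib_left[symmetric] by simp
  qed
  finally show ?thesis by (simp add: mult.assoc)
qed

text \<open>The common factor in the upper and the lower bound for the power sums: up to a constant it is
  \<open>(2 powr (1 - H p)) ^ n\<close>, which decays exactly when \<open>H p > 1\<close>.\<close>
lemma level_var_powr: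
  "level_var n powr (p / 2) * 2 ^ n
     = sec_diff_cov H 0 powr (p / 2) * 2 powr (- H * p) * (2 powr (1 - H * p)) ^ n"
proof -
  have "(1 / 2 ^ (n + 1) :: real) = 2 powr (- real (n + 1))"
    by (subst powr_minus_divide, subst powr_realpow) simp_all
  moreover have "- real (n + 1) * (2 * H) * (p / 2) = - real (n + 1) * H * p"
    by simp
  ultimately have "level_var n powr (p / 2) = 2 powr (- real (n + 1) * H * p) * sec_diff_cov H 0 powr (p / 2)"
    by (simp only: level_var_def powr_mult powr_powr)
  moreover have "2 powr (- real (n + 1) * H * p) * 2 ^ n = 2 powr (- H * p) * (2 powr (1 - H * p)) ^ n"
    by (simp add: powr_realpow[symmetric] powr_powr powr_add[symmetric] algebra_simps)
  ultimately show ?thesis by simp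
qed

text \<open>Convergence in the mean gives almost sure convergence of the cosine averages along a subsequence
  of levels, and there the power sums stay above \<open>c\<close>. A subsequence is enough, since for a path
  in the energy space the whole sequence tends to zero.\<close>
lemma AE_not_in_energy_space:
  assumes p: "p > 0" and "H * p \<le> 1"
  shows "AE \<omega> in M. (\<lambda>t. B t \<omega>) \<notin> energy_space p"
proof -
  have "(\<lambda>n. expectation (\<lambda>\<omega>. norm ((cos_mean n \<omega> - exp (- 1 / 2))\<^sup>2))) \<longlonglongrightarrow> 0"
    using cos_mean_variance_tendsto_0 by simp
  from tendsto_L1_AE_subseq[OF cos_mean_variance(1) this]
  obtain r where r: "strict_mono r"
    and AE: "AE \<omega> in M. (\<lambda>n. (cos_mean (r n) \<omega> - exp (- 1 / 2))\<^sup>2) \<longlonglongrightarrow> 0" by blast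
  \<comment> \<open>The lower bound on \<open>S n\<close> at levels where the cosine average is below \<open>3/4 = 7/8 - 1/8\<close>.\<close>
  define c where "c = sec_diff_cov H 0 powr (p / 2) * 2 powr (- H * p) * ((1/2) powr p / 2 * (1/8))"
  have c: "c > 0"
    using H_bounds sec_diff_cov_0_pos[of H] by (simp add: c_def)
  have exp_half: "exp (- 1 / 2) < (3 / 4 :: real)"
  proof -
    have "3 / 2 \<le> exp (1 / 2 :: real)" using exp_ge_add_one_self[of "1/2"] by simp
    then have "inverse (exp (1/2)) \<le> inverse (3 / 2 :: real)" by (intro le_imp_inverse_le) auto
    then show ?thesis by (simp add: exp_minus[symmetric])
  qed
  show ?thesis
    using AE
  proof eventually_elim
    case (elim \<omega>)
    show ?case
    proof
      assume "(\<lambda>t. B t \<omega>) \<in> energy_space p"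
      then have "level_power_sum p (\<lambda>t. B t \<omega>) \<longlonglongrightarrow> 0"
        by (rule energy_space_imp_level_power_sums_null[OF p])
      then have "(\<lambda>n. level_power_sum p (\<lambda>t. B t \<omega>) (r n)) \<longlonglongrightarrow> 0"
        using LIMSEQ_subseq_LIMSEQ[OF _ r] by (auto simp: o_def)
      then have small: "\<forall>\<^sub>F n in sequentially. level_power_sum p (\<lambda>t. B t \<omega>) (r n) < c"
        by (rule order_tendstoD) (rule c)
      have "(\<lambda>n. \<bar>cos_mean (r n) \<omega> - exp (- 1 / 2)\<bar>) \<longlonglongrightarrow> 0"
        using tendsto_real_sqrt[OF elim] by simp
      then have "(\<lambda>n. cos_mean (r n) \<omega>) \<longlonglongrightarrow> exp (- 1 / 2)"
        by (simp add: LIM_zero_iff tendsto_rabs_zero_iff)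
      then have "\<forall>\<^sub>F n in sequentially. cos_mean (r n) \<omega> < 3 / 4"
        using exp_half by (rule order_tendstoD)
      with small have "\<forall>\<^sub>F n in sequentially. False"
      proof eventually_elim
        case (elim n)
        have "c = sec_diff_cov H 0 powr (p / 2) * 2 powr (- H * p) * 1 * ((1/2) powr p / 2 * (1/8))"
          by (simp add: c_def)
        also have "\<dots> \<le> sec_diff_cov H 0 powr (p / 2) * 2 powr (- H * p) * (2 powr (1 - H * p)) ^ r n
            * ((1/2) powr p / 2 * (7/8 - cos_mean (r n) \<omega>))"
          using assms elim
          by (intro mult_mono mult_left_mono one_le_power ge_one_powr_ge_zero) auto
        also have "\<dots> \<le> level_power_sum p (\<lambda>t. B t \<omega>) (r n)"
          using level_power_sum_ge_cos_mean[OF p, where n = "r n"] unfolding level_var_powr by simp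
        finally show False using elim by simp
      qed
      then show False by simp
    qed
  qed
qed

text \<open>The means of the power sums decay like \<open>b ^ n\<close> with \<open>b < 1\<close>. Dividing by \<open>(sqrt b) ^ n\<close> keeps the
  series of the means convergent, so the quotients are almost surely summable and in particular
  bounded.\<close>
lemma AE_in_energy_space:
  assumes p: "p > 0" and "H * p > 1"
  shows "AE \<omega> in M. (\<lambda>t. B t \<omega>) \<in> energy_space p"
proof -
  define b where "b = 2 powr (1 - H * p)"
  define s where "s = sqrt b"
  have b: "0 < b" "b < 1"
    using assms by (auto simp: b_def powr_less_one)
  then have s: "0 < s" "s < 1" and ss: "b = s * s"
    by (simp_all add: s_def)
  obtain K where K: "normal_abs_moment p = ennreal K" "0 \<le> K"
    using normal_abs_moment_finite[OF p] by (cases "normal_abs_moment p") auto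
  define C where "C = sec_diff_cov H 0 powr (p / 2) * 2 powr (- H * p) * K"
  have C: "0 \<le> C" using K by (simp add: C_def)
  have meas: "(\<lambda>\<omega>. \<bar>D n k \<omega>\<bar> powr p) \<in> borel_measurable M" if "k < 2 ^ n" for n k
    using gaussian_D[OF that]
    by (intro powr_real_measurable borel_measurable_abs borel_measurable_const)
      (simp add: gaussian_rv_def)
  let ?S = "\<lambda>n \<omega>. level_power_sum p (\<lambda>t. B t \<omega>) n"
  have [measurable]: "?S n \<in> borel_measurable M" for n
    unfolding level_power_sum_def by (intro borel_measurable_sum meas) simp
  have ES: "(\<integral>\<^sup>+\<omega>. ennreal (?S n \<omega>) \<partial>M) = ennreal (C * b ^ n)" for n
  proof -
    have "(\<integral>\<^sup>+\<omega>. ennreal (?S n \<omega>) \<partial>M) = (\<integral>\<^sup>+\<omega>. (\<Sum>k<2 ^ n. ennreal (\<bar>D n k \<omega>\<bar> powr p)) \<partial>M)"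
      by (simp add: level_power_sum_def)
    also have "\<dots> = (\<Sum>k<2 ^ n. \<integral>\<^sup>+\<omega>. ennreal (\<bar>D n k \<omega>\<bar> powr p) \<partial>M)"
      by (intro nn_integral_sum measurable_compose[OF meas measurable_ennreal]) simp
    also have "\<dots> = (\<Sum>k<(2::nat) ^ n. ennreal (level_var n powr (p / 2)) * ennreal K)"
      unfolding K(1)[symmetric]
      by (intro sum.cong refl gaussian_abs_moment gaussian_D expectation_D expectation_D_square
          level_var_pos) simp_all
    also have "\<dots> = ennreal ((level_var n powr (p / 2) * 2 ^ n) * K)"
      using K by (simp add: ennreal_mult' ac_simps ennreal_power[symmetric])
    also have "(level_var n powr (p / 2) * 2 ^ n) * K = C * b ^ n"
      unfolding level_var_powr by (simp add: C_def b_def)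
    finally show ?thesis .
  qed
  have "(\<integral>\<^sup>+\<omega>. (\<Sum>n. ennreal (?S n \<omega> / s ^ n)) \<partial>M) = (\<Sum>n. \<integral>\<^sup>+\<omega>. ennreal (?S n \<omega> / s ^ n) \<partial>M)"
    by (intro nn_integral_suminf) measurable
  also have "\<dots> = (\<Sum>n. ennreal (C * s ^ n))"
  proof (intro suminf_cong)
    fix n
    have "(\<integral>\<^sup>+\<omega>. ennreal (?S n \<omega> / s ^ n) \<partial>M) = (\<integral>\<^sup>+\<omega>. ennreal (1 / s ^ n) * ennreal (?S n \<omega>) \<partial>M)"
      using s by (simp add: ennreal_mult'[symmetric])
    also have "\<dots> = ennreal (1 / s ^ n) * ennreal (C * b ^ n)"
      by (subst nn_integral_cmult) (auto simp: ES)
    also have "\<dots> = ennreal (C * s ^ n)"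
      using s by (simp add: ennreal_mult'[symmetric] ss power_mult_distrib)
    finally show "(\<integral>\<^sup>+\<omega>. ennreal (?S n \<omega> / s ^ n) \<partial>M) = ennreal (C * s ^ n)" .
  qed
  also have "\<dots> = ennreal (C / (1 - s))"
    using s C by (intro suminf_ennreal_eq)
      (auto intro: sums_mult[OF geometric_sums, of s C, simplified])
  finally have "(\<integral>\<^sup>+\<omega>. (\<Sum>n. ennreal (?S n \<omega> / s ^ n)) \<partial>M) \<noteq> \<infinity>" by simp
  then have "AE \<omega> in M. (\<Sum>n. ennreal (?S n \<omega> / s ^ n)) \<noteq> \<infinity>"
    by (intro nn_integral_PInf_AE) measurable
  then show ?thesis
    using AE_space
  proof eventually_elim
    case (elim \<omega>)
    define L where "L = enn2real (\<Sum>n. ennreal (?S n \<omega> / s ^ n))"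
    have L: "ennreal L = (\<Sum>n. ennreal (?S n \<omega> / s ^ n))" "0 \<le> L"
      using elim by (simp_all add: L_def less_top)
    have bound: "?S n \<omega> \<le> L * s ^ n" for n
    proof -
      have "ennreal (?S n \<omega> / s ^ n) \<le> ennreal L"
        unfolding L(1) using sum_le_suminf[of "\<lambda>n. ennreal (?S n \<omega> / s ^ n)" "{n}"] by simp
      then have "?S n \<omega> / s ^ n \<le> L"
        using L(2) by (simp add: ennreal_le_iff)
      then show ?thesis using s by (simp add: field_simps)
    qed
    show ?case
    proof (rule energy_space_if_geometric[OF p continuous_paths])
      show "0 < s powr (1 / p)" "s powr (1 / p) < 1"
        using s p by (simp_all add: powr01_less_one)
      show "?S n \<omega> powr (1 / p) \<le> L powr (1 / p) * (s powr (1 / p)) ^ n" for n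
      proof -
        have "?S n \<omega> powr (1 / p) \<le> (L * s ^ n) powr (1 / p)"
          using p bound level_power_sum_nonneg by (intro powr_mono2) auto
        also have "\<dots> = L powr (1 / p) * (s powr (1 / p)) ^ n"
          using s by (simp add: powr_mult powr_realpow[symmetric] powr_powr mult.commute)
        finally show ?thesis .
      qed
    qed (use elim in auto)
  qed
qed

end

theorem theorem4p9:
  fixes M :: "'a measure" and B :: "real \<Rightarrow> 'a \<Rightarrow> real" and p H :: real
  assumes "p > 1" and "0 < H" and "H < 1"
    and "fractional_brownian_motion M H B"
  shows "{\<omega> \<in> space M. (\<lambda>t. B t \<omega>) \<in> energy_space p} \<in> sets M \<and>
    measure M {\<omega> \<in> space M. (\<lambda>t. B t \<omega>) \<in> energy_space p} = (if H > 1 / p then 1 else 0) \<and>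
    ((AE \<omega> in M. (\<lambda>t. B t \<omega>) \<in> energy_space p) \<longleftrightarrow> H > 1 / p)"
proof -
  interpret fbm M H B
    using assms(4) by unfold_locales
  let ?E = "{\<omega> \<in> space M. (\<lambda>t. B t \<omega>) \<in> energy_space p}"
  have sets: "?E \<in> sets M"
    using gaussian_B continuous_paths by (intro sets_energy_space) (auto simp: gaussian_rv_def)
  have iff: "H > 1 / p \<longleftrightarrow> H * p > 1"
    using assms(1) by (simp add: field_simps)
  show ?thesis
  proof (cases "H > 1 / p")
    case True
    then have AE: "AE \<omega> in M. (\<lambda>t. B t \<omega>) \<in> energy_space p"
      using AE_in_energy_space iff assms(1) by simp
    then have "measure M ?E = 1"
      using prob_Collect_eq_1[OF sets] by simp
    with sets AE True show ?thesis by simp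
  next
    case False
    then have AE: "AE \<omega> in M. (\<lambda>t. B t \<omega>) \<notin> energy_space p"
      using AE_not_in_energy_space iff assms(1) by simp
    then have "measure M ?E = 0"
      using prob_Collect_eq_0[OF sets] by simp
    moreover have "\<not> (AE \<omega> in M. (\<lambda>t. B t \<omega>) \<in> energy_space p)"
    proof
      assume "AE \<omega> in M. (\<lambda>t. B t \<omega>) \<in> energy_space p"
      with AE have "AE \<omega> in M. False" by eventually_elim simp
      then show False by simp
    qed
    ultimately show ?thesis
      using sets False by simp
  qed
qed

end
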